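(* Let $d\in\mathbb{N}$ be odd, let $\chi$ be a Dirichlet character with conductor $d$, let $r\in\mathbb{N}$, let $q\in\mathbb{C}$ with $0<|q|<1$, and let $a,b\in\mathbb{N}$ with $a\equiv 1\pmod 2$ and $b\equiv 1\pmod 2$. Then for every integer $n\ge 0$ and every real $x$, \[ [2]_{q^b}^r\sum_{i=0}^{n}\binom{n}{i}[a]_q^{n-i}[b]_q^{i}\,E^{(r)}_{n-i,\chi,q^a}(bx)\,S^{(r)}_{n,i,q^b}(ad\,|\,\chi) =[2]_{q^a}^r\sum_{i=0}^{n}\binom{n}{i}[b]_q^{n-i}[a]_q^{i}\,E^{(r)}_{n-i,\chi,q^b}(ax)\,S^{(r)}_{n,i,q^a}(bd\,|\,\chi). \]
   Context: Fix a value of $\log q$ and, for real $y$ and $c\in\mathbb{N}$, set $(q^c)^y=e^{cy\log q}$. For $p=q^c$ ($c\in\mathbb{N}$) and real $y$, $[y]_p=\frac{1-p^y}{1-p}$, and $[2]_p^r$ is the $r$-th power of $[2]_p$. The generalized higher-order $q$-Euler polynomials $E^{(r)}_{n,\chi,p}(y)$ attached to $\chi$ are defined by the generating function \[ [2]_p^r\sum_{m_1,\dots,m_r=0}^{\infty}(-p)^{m_1+\cdots+m_r}\Big(\prod_{i=1}^r\chi(m_i)\Big)e^{[m_1+\cdots+m_r+y]_p\,t}=\sum_{n=0}^{\infty}E^{(r)}_{n,\chi,p}(y)\frac{t^n}{n!}, \] where $\chi(m)$ is the value of the Dirichlet character at the integer $m$. For $N\in\mathbb{N}$ and integers $0\le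 i\le n$, the alternating $q$-power sum is \[ S^{(r)}_{n,i,p}(N\,|\,\chi)=\sum_{j_1,\dots,j_r=0}^{N-1}(-1)^{j_1+\cdots+j_r}\Big(\prod_{l=1}^r\chi(j_l)\Big)p^{(n-i+1)\sum_{l=1}^r j_l}\Big[\sum_{l=1}^r j_l\Big]_p^{\,i}. \] *)

theory Defs
  imports "HOL-Complex_Analysis.Complex_Analysis" "HOL-Number_Theory.Number_Theory"
begin

definition dirichlet_character :: "nat \<Rightarrow> (int \<Rightarrow> complex) \<Rightarrow> bool" where
  "dirichlet_character N chi \<longleftrightarrow>
     N > 0 \<and> chi 1 = 1 \<and>
     (\<forall>m n. chi (m * n) = chi m * chi n) \<and>
     (\<forall>m n. [m = n] (mod int N) \<longrightarrow> chi m = chi n) \<and>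
     (\<forall>m. chi m = 0 \<longleftrightarrow> \<not> coprime m (int N))"

(* f is an induced modulus of a character modulo N if the character is trivial on the units
   modulo N that are congruent to 1 modulo f; the conductor is the least induced modulus. *)
definition induced_modulus :: "nat \<Rightarrow> (int \<Rightarrow> complex) \<Rightarrow> nat \<Rightarrow> bool" where
  "induced_modulus N chi f \<longleftrightarrow>
     f > 0 \<and> f dvd N \<and> (\<forall>m. coprime m (int N) \<and> [m = 1] (mod int f) \<longrightarrow> chi m = 1)"

definition dirichlet_conductor :: "nat \<Rightarrow> (int \<Rightarrow> complex) \<Rightarrow> nat" where
  "dirichlet_conductor N chi = (LEAST f. induced_modulus N chi f)"

(* In the remaining definitions L is the chosen logarithm of q (so q = exp L is intended) and
   the base is p = q^c.  The power p^y for real y depends on L. *)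

definition base_powr :: "complex \<Rightarrow> nat \<Rightarrow> real \<Rightarrow> complex" where
  "base_powr L c y = exp (of_nat c * of_real y * L)"

definition q_number :: "complex \<Rightarrow> complex \<Rightarrow> nat \<Rightarrow> real \<Rightarrow> complex" where
  "q_number q L c y = (1 - base_powr L c y) / (1 - q ^ c)"

(* The r-fold series over m_1, ..., m_r is the unconditional sum over all functions
   {1..r} -> nat; it converges absolutely when |q| < 1 and c > 0. *)
definition q_Euler_gen_fun ::
    "nat \<Rightarrow> (int \<Rightarrow> complex) \<Rightarrow> complex \<Rightarrow> complex \<Rightarrow> nat \<Rightarrow> real \<Rightarrow> complex \<Rightarrow> complex" where
  "q_Euler_gen_fun r chi q L c y t =
     q_number q L c 2 ^ r *
     (\<Sum>\<^sub>\<infinity>m\<in>{1..r} \<rightarrow>\<^sub>E (UNIV :: nat set).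
        (- (q ^ c)) ^ (\<Sum>i=1..r. m i) * (\<Prod>i=1..r. chi (int (m i))) *
        exp (q_number q L c (real (\<Sum>i=1..r. m i) + y) * t))"

definition q_Euler_poly ::
    "nat \<Rightarrow> (int \<Rightarrow> complex) \<Rightarrow> complex \<Rightarrow> complex \<Rightarrow> nat \<Rightarrow> nat \<Rightarrow> real \<Rightarrow> complex" where
  "q_Euler_poly r chi q L c n y =
     fact n * fps_nth (fps_expansion (q_Euler_gen_fun r chi q L c y) 0) n"

(* Used only for i \<le> n, where n - i on the naturals is the ordinary difference. *)
definition alt_q_power_sum ::
    "nat \<Rightarrow> (int \<Rightarrow> complex) \<Rightarrow> complex \<Rightarrow> complex \<Rightarrow> nat \<Rightarrow> nat \<Rightarrow> nat \<Rightarrow> nat \<Rightarrow> complex" where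
  "alt_q_power_sum r chi q L c n i N =
     (\<Sum>j\<in>{1..r} \<rightarrow>\<^sub>E {..<N}.
        (- 1) ^ (\<Sum>l=1..r. j l) * (\<Prod>l=1..r. chi (int (j l))) *
        (q ^ c) ^ ((n - i + 1) * (\<Sum>l=1..r. j l)) *
        q_number q L c (real (\<Sum>l=1..r. j l)) ^ i)"

end

theory Submission
  imports Defs
begin

text \<open>
  Extracting coefficients from the generating function gives
  $E_n(y) = [2]_p^r \sum_m (-p)^{|m|} \chi(m) [|m|+y]_p^n$. Summing over $i$ with the binomial
  theorem then merges $[a]_q[|m|+bx]_{q^a}$ and $[b]_q[|j|]_{q^b}$ into $[a|m|+b|j|+abx]_q^n$.
  Expanding this power once more in powers of $q^{a|m|+b|j|}$ makes the sums over $m$ and $j$ split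
  into one-dimensional ones: with $f(z) = \sum_k (-z)^k\chi(k)$ and $Q = q^{s+1}$, the sum
  over $m$ is $f(Q^a)^r$. The sum over $j$ is $((1+Q^{abd}) f(Q^b))^r$, because
  the coefficients of $f$ change sign under a shift by the odd period $ad$.
  The resulting expression is symmetric in $a$ and $b$.
\<close>

section \<open>Taylor coefficients of exponential generating series\<close>

text \<open>Since the \<open>z m\<close> are bounded by \<open>C\<close>, the family
  \<open>w m * (z m * t) ^ k / fact k\<close> over all pairs (m, k) is absolutely summable, with
  absolute row sums at most \<open>norm (w m) * exp (C * norm t)\<close>. Summed by rows it gives
  the generating function, by columns its Taylor series.\<close>

lemma infsum_exp_fps_coeff_has_sum:
  fixes w z :: "'a \<Rightarrow> complex"
  assumes w: "(\<lambda>m. norm (w m)) summable_on I"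
    and z: "\<And>m. m \<in> I \<Longrightarrow> norm (z m) \<le> C"
  shows "((\<lambda>m. w m * z m ^ n) has_sum
           fact n * fps_nth (fps_expansion (\<lambda>t. \<Sum>\<^sub>\<infinity>m\<in>I. w m * exp (z m * t)) 0) n) I"
proof -
  define M where "M k = (\<Sum>\<^sub>\<infinity>m\<in>I. w m * z m ^ k)" for k
  define F where "F = (\<lambda>t. \<Sum>\<^sub>\<infinity>m\<in>I. w m * exp (z m * t))"
  have M: "((\<lambda>m. w m * z m ^ k) has_sum M k) I" for k
  proof -
    have "(\<lambda>m. norm (w m * z m ^ k)) summable_on I"
    proof (rule Infinite_Sum.abs_summable_on_comparison_test')
      show "(\<lambda>m. norm (w m) * C ^ k) summable_on I"
        using w by (rule summable_on_cmult_left)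
      show "norm (w m * z m ^ k) \<le> norm (w m) * C ^ k" if "m \<in> I" for m
        unfolding norm_mult norm_power
        by (intro mult_left_mono power_mono z that) auto
    qed
    then show ?thesis
      unfolding M_def by (rule has_sum_infsum[OF abs_summable_summable])
  qed
  have F_sums: "(\<lambda>k. M k / fact k * t ^ k) sums F t" for t
  proof -
    define g where "g = (\<lambda>(m, k::nat). w m * ((z m * t) ^ k /\<^sub>R fact k))"
    have norm_sums: "(\<lambda>k. norm (g (m, k))) sums (norm (w m) * exp (norm (z m * t)))" for m
      using sums_mult[OF exp_converges[of "norm (z m * t)"], of "norm (w m)"]
      by (simp add: g_def norm_mult norm_power divide_inverse power_mult_distrib mult_ac)
    have row: "((\<lambda>k. g (m, k)) has_sum (w m * exp (z m * t))) UNIV" for m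
    proof (rule norm_summable_imp_has_sum)
      show "summable (\<lambda>k. norm (g (m, k)))"
        using norm_sums by (rule sums_summable)
      show "(\<lambda>k. g (m, k)) sums (w m * exp (z m * t))"
        using sums_mult[OF exp_converges[of "z m * t"], of "w m"] by (simp add: g_def)
    qed
    have norm_row: "((\<lambda>k. norm (g (m, k))) has_sum (norm (w m) * exp (norm (z m * t)))) UNIV" for m
      using norm_sums sums_summable[OF norm_sums] by (intro norm_summable_imp_has_sum) simp_all
    have "(\<lambda>p. norm (g p)) summable_on I \<times> UNIV"
      unfolding Infinite_Sum.abs_summable_on_Sigma_iff
    proof (intro conjI ballI)
      show "(\<lambda>k. norm (g (m, k))) summable_on UNIV" for m
        using norm_row by (rule has_sum_imp_summable)
      show "(\<lambda>m. norm (\<Sum>\<^sub>\<infinity>k. norm (g (m, k)))) summable_on I"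
      proof (rule Infinite_Sum.abs_summable_on_comparison_test')
        show "(\<lambda>m. norm (w m) * exp (C * norm t)) summable_on I"
          using w by (rule summable_on_cmult_left)
        show "norm (\<Sum>\<^sub>\<infinity>k. norm (g (m, k))) \<le> norm (w m) * exp (C * norm t)" if "m \<in> I" for m
          using z[OF that] by (simp add: infsumI[OF norm_row] norm_mult mult_left_mono mult_right_mono)
      qed
    qed
    then obtain S where S: "(g has_sum S) (I \<times> UNIV)"
      using abs_summable_summable[of g] unfolding summable_on_def by blast
    have "((\<lambda>m. w m * exp (z m * t)) has_sum S) I"
      by (rule has_sum_SigmaD[OF S row])
    then have "F t = S"
      unfolding F_def by (rule infsumI)
    have S': "((\<lambda>(k, m). g (m, k)) has_sum S) (UNIV \<times> I)"
      using S has_sum_swap[where f = g] by (simp add: case_prod_unfold)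
    have col: "((\<lambda>m. g (m, k)) has_sum (M k / fact k * t ^ k)) I" for k
      using has_sum_cmult_left[OF M[of k], of "t ^ k / fact k"]
      by (simp add: g_def power_mult_distrib scaleR_conv_of_real divide_inverse mult_ac)
    have "((\<lambda>k. M k / fact k * t ^ k) has_sum S) UNIV"
      by (rule has_sum_SigmaD[OF S']) (use col in simp)
    then show ?thesis
      unfolding \<open>F t = S\<close> by (rule has_sum_imp_sums)
  qed
  have "F has_fps_expansion Abs_fps (\<lambda>k. M k / fact k)"
    unfolding has_fps_expansion_def
  proof
    \<comment> \<open>Only a positive radius is needed, so convergence at t = 1 suffices.\<close>
    have "norm (1::complex) \<le> fps_conv_radius (Abs_fps (\<lambda>k. M k / fact k))"
      unfolding fps_conv_radius_def
      by (rule conv_radius_geI) (use F_sums[of 1] in \<open>simp add: sums_iff\<close>)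
    then show "0 < fps_conv_radius (Abs_fps (\<lambda>k. M k / fact k))"
      by (smt (verit) ereal_less(2) norm_one order_less_le_trans zero_less_one)
    show "\<forall>\<^sub>F t in nhds 0. eval_fps (Abs_fps (\<lambda>k. M k / fact k)) t = F t"
      using F_sums by (simp add: eval_fps_def sums_iff)
  qed
  then have "fps_expansion F 0 = Abs_fps (\<lambda>k. M k / fact k)"
    by (rule fps_expansion_eqI)
  then have "fact n * fps_nth (fps_expansion F 0) n = M n"
    by simp
  then show ?thesis
    using M[of n] unfolding F_def by simp
qed

section \<open>Alternating series of a periodic sequence\<close>

lemma abs_summable_on_prod_PiE_nat:
  fixes f :: "nat \<Rightarrow> complex"
  assumes "(\<lambda>k. norm (f k)) summable_on UNIV" "finite A"
  shows "(\<lambda>m. norm (\<Prod>l\<in>A. f (m l))) summable_on (A \<rightarrow>\<^sub>E UNIV)"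
  using assms abs_summable_on_prod_PiE[of A "\<lambda>_. UNIV" "\<lambda>_. f"]
  by (simp add: abs_summable_equivalent)

definition alternating_series :: "(int \<Rightarrow> complex) \<Rightarrow> complex \<Rightarrow> complex" where
  "alternating_series chi z = (\<Sum>\<^sub>\<infinity>k. (- z) ^ k * chi (int k))"

lemma periodic_bounded:
  fixes chi :: "int \<Rightarrow> complex"
  assumes "N > 0" "\<And>k. chi (int (k + N)) = chi (int k)"
  shows "\<exists>K. \<forall>k. norm (chi (int k)) \<le> K"
proof -
  have mod: "chi (int k) = chi (int (k mod N))" for k
  proof (induction k rule: less_induct)
    case (less k)
    show ?case
    proof (cases "k < N")
      case False
      then show ?thesis
        using less[of "k - N"] assms(2)[of "k - N"] \<open>N > 0\<close> by (simp add: le_mod_geq)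
    qed simp
  qed
  have "norm (chi (int k)) \<le> Max ((\<lambda>k. norm (chi (int k))) ` {..<N})" for k
    using \<open>N > 0\<close> by (subst mod) (intro Max_ge, auto)
  then show ?thesis
    by blast
qed

lemma alternating_series_abs_summable:
  fixes chi :: "int \<Rightarrow> complex"
  assumes "N > 0" "\<And>k. chi (int (k + N)) = chi (int k)" "norm z < 1"
  shows "(\<lambda>k. norm ((- z) ^ k * chi (int k))) summable_on (UNIV :: nat set)"
proof -
  obtain K where K: "\<And>k. norm (chi (int k)) \<le> K"
    using periodic_bounded[of N chi, OF assms(1,2)] by blast
  have "summable (\<lambda>k. norm z ^ k * K)"
    using assms(3) by (intro summable_mult2 summable_geometric) simp
  moreover have "0 \<le> norm z ^ k * K" for k
    using order_trans[OF norm_ge_zero K[of 0]] by simp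
  ultimately have "(\<lambda>k. norm z ^ k * K) summable_on UNIV"
    by (intro norm_summable_imp_summable_on) simp
  then show ?thesis
    by (rule Infinite_Sum.abs_summable_on_comparison_test')
      (simp add: norm_mult norm_power K mult_left_mono)
qed

text \<open>For odd \<open>N\<close>, shifting by one period multiplies each term by
  \<open>- (z ^ N)\<close>. The tail from \<open>N\<close> on is therefore \<open>- (z ^ N)\<close>
  times the whole series, and removing it leaves the factor \<open>1 + z ^ N\<close>.\<close>

lemma sum_alternating_eq_series:
  assumes "odd N" "\<And>k. chi (int (k + N)) = chi (int k)" "norm z < 1"
  shows "(\<Sum>k<N. (- z) ^ k * chi (int k)) = (1 + z ^ N) * alternating_series chi z"
proof -
  define f where "f k = (- z) ^ k * chi (int k)" for k
  have "N > 0"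
    using \<open>odd N\<close> by (rule odd_pos)
  then have "f summable_on UNIV"
    unfolding f_def
    by (intro abs_summable_summable[OF alternating_series_abs_summable[of N chi z, OF _ assms(2,3)]])
  then have "(f has_sum alternating_series chi z) UNIV"
    unfolding alternating_series_def f_def[symmetric] by (rule has_sum_infsum)
  then have sums: "f sums alternating_series chi z"
    by (rule has_sum_imp_sums)
  have "f (k + N) = - (z ^ N) * f k" for k
    using assms(1) by (simp add: f_def power_add assms(2) del: of_nat_add)
  then have "(\<lambda>k. f (k + N)) sums (- (z ^ N) * alternating_series chi z)"
    using sums_mult[OF sums, of "- (z ^ N)"] by simp
  moreover have "(\<lambda>k. f (k + N)) sums (alternating_series chi z - (\<Sum>k<N. f k))"
    using sums by (rule sums_split_initial_segment)
  ultimately have "- (z ^ N) * alternating_series chi z = alternating_series chi z - (\<Sum>k<N. f k)"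
    by (rule sums_unique2)
  then show ?thesis
    unfolding f_def by (simp add: algebra_simps)
qed

section \<open>Series form of the q-Euler polynomials\<close>

text \<open>Coefficient extraction applies because the q-numbers in the exponents are bounded
  uniformly in m. Weight and character are grouped into one product over the coordinates, so that
  r-fold sums can later be factored.\<close>

lemma q_Euler_poly_has_sum:
  assumes "N > 0" "\<And>k. chi (int (k + N)) = chi (int k)"
    and q: "norm q < 1" "exp L = q" and "c > 0"
  shows "((\<lambda>m. q_number q L c 2 ^ r * (\<Prod>i=1..r. (- (q ^ c)) ^ m i * chi (int (m i))) *
             q_number q L c (real (\<Sum>i=1..r. m i) + y) ^ n) has_sum
           q_Euler_poly r chi q L c n y) ({1..r} \<rightarrow>\<^sub>E UNIV)"
proof -
  define w where "w m = q_number q L c 2 ^ r * (\<Prod>i=1..r. (- (q ^ c)) ^ m i * chi (int (m i)))" for m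
  have qc: "norm (q ^ c) < 1"
    using q(1) \<open>c > 0\<close> by (simp add: norm_power power_less_one_iff)
  have gen_fun: "q_Euler_gen_fun r chi q L c y =
      (\<lambda>t. \<Sum>\<^sub>\<infinity>m\<in>{1..r} \<rightarrow>\<^sub>E UNIV. w m * exp (q_number q L c (real (\<Sum>i=1..r. m i) + y) * t))"
    unfolding q_Euler_gen_fun_def w_def
    \<comment> \<open>A constant factor may enter the infinite sum here without any summability
      condition.\<close>
    by (subst infsum_cmult_right' [symmetric])
      (simp add: prod.distrib power_sum mult_ac del: of_nat_sum)
  have abs: "(\<lambda>m. norm (w m)) summable_on ({1..r} \<rightarrow>\<^sub>E UNIV)"
    unfolding w_def norm_mult[of "q_number q L c 2 ^ r"]
    by (intro summable_on_cmult_right abs_summable_on_prod_PiE_nat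
          alternating_series_abs_summable[of N chi, OF assms(1,2)] qc) simp
  have bound: "norm (q_number q L c (real k + y)) \<le> (1 + norm (base_powr L c y)) / norm (1 - q ^ c)" for k
  proof -
    have "base_powr L c (real k + y) = (q ^ c) ^ k * base_powr L c y"
      unfolding base_powr_def q(2)[symmetric]
      by (simp add: algebra_simps flip: exp_add exp_of_nat_mult)
    moreover have "norm ((q ^ c) ^ k * base_powr L c y) \<le> 1 * norm (base_powr L c y)"
      unfolding norm_mult norm_power[of _ k] using qc
      by (intro mult_right_mono power_le_one) auto
    ultimately have "norm (1 - base_powr L c (real k + y)) \<le> 1 + norm (base_powr L c y)"
      using norm_triangle_ineq4[of 1 "base_powr L c (real k + y)"] by simp
    then show ?thesis
      unfolding q_number_def norm_divide by (intro divide_right_mono) auto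
  qed
  show ?thesis
    unfolding q_Euler_poly_def gen_fun
    using infsum_exp_fps_coeff_has_sum[OF abs bound] unfolding w_def .
qed

section \<open>Algebra of a single summand\<close>

text \<open>A power of \<open>y\<close> whose exponent is the total of the \<open>m l\<close>
  spreads over the coordinates and merely replaces \<open>p\<close> by \<open>p * y ^ s\<close>, so
  the product form survives.\<close>

lemma prod_power_shift:
  fixes p y :: "'a :: comm_ring_1"
  shows "(\<Prod>l\<in>A. (- p) ^ m l * c l) * (y ^ (\<Sum>l\<in>A. m l)) ^ s = (\<Prod>l\<in>A. (- (p * y ^ s)) ^ m l * c l)"
proof -
  have "(y ^ (\<Sum>l\<in>A. m l)) ^ s = (\<Prod>l\<in>A. (y ^ s) ^ m l)"
    by (metis power_mult mult.commute power_sum)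
  then show ?thesis
    by (simp add: mult_ac flip: prod.distrib) (simp add: power_mult_distrib flip: mult_minus_left)
qed

lemma has_sum_sum_left:
  fixes f :: "'i \<Rightarrow> 'a \<Rightarrow> 'b :: topological_comm_monoid_add"
  assumes "\<And>i. i \<in> I \<Longrightarrow> (f i has_sum S i) A"
  shows "((\<lambda>x. \<Sum>i\<in>I. f i x) has_sum (\<Sum>i\<in>I. S i)) A"
  using assms by (induction I rule: infinite_finite_induct) (auto intro: has_sum_add)

text \<open>With the abbreviations of the proof, the sum over i equals
  \<open>v * (B + v * A) ^ n\<close>, and \<open>B + v * A\<close> is the q-number of aM + bJ + abx.
  A second binomial expansion then separates \<open>M\<close> from \<open>J\<close>.\<close>

lemma q_binomial_sum:
  assumes q: "norm q < 1" "exp L = q" and "a > 0" "b > 0"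
  shows "(\<Sum>i=0..n. of_nat (n choose i) * q_number q L 1 (real a) ^ (n - i) *
            q_number q L 1 (real b) ^ i *
            q_number q L a (real M + real b * x) ^ (n - i) *
            ((q ^ b) ^ ((n - i + 1) * J) * q_number q L b (real J) ^ i)) =
         (\<Sum>s\<le>n. of_nat (n choose s) * (- exp (of_real (real a * real b * x) * L)) ^ s / (1 - q) ^ n *
            ((q ^ a) ^ M) ^ s * ((q ^ b) ^ J) ^ (s + 1))"
proof -
  \<comment> \<open>\<open>Y\<close> carries the minus sign, so that the merged numerator reads
    \<open>1 + Y * (u * v)\<close>.\<close>
  define u v Y where "u = (q ^ a) ^ M" and "v = (q ^ b) ^ J"
    and "Y = - exp (of_real (real a * real b * x) * L)"
  define A where "A = q_number q L 1 (real a) * q_number q L a (real M + real b * x)"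
  define B where "B = q_number q L 1 (real b) * q_number q L b (real J)"
  have ne: "1 - q ^ c \<noteq> 0" if "c > 0" for c
  proof -
    have "norm (q ^ c) < 1"
      using q(1) that by (simp add: norm_power power_less_one_iff)
    then show ?thesis
      by force
  qed
  have pow: "exp (of_nat k * L) = q ^ k" for k
    using q(2) by (simp add: exp_of_nat_mult)
  \<comment> \<open>The numerator \<open>1 - q ^ a\<close> of the first q-number cancels the
    denominator of the second.\<close>
  have A: "A = (1 + u * Y) / (1 - q)"
  proof -
    have "base_powr L a (real M + real b * x) = exp (of_nat (a * M) * L) * - Y"
      unfolding base_powr_def Y_def minus_minus exp_add[symmetric] by (simp add: algebra_simps)
    then have "base_powr L a (real M + real b * x) = - (u * Y)"
      unfolding pow u_def by (simp add: power_mult)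
    then show ?thesis
      using ne[OF \<open>a > 0\<close>] pow[of a] by (simp add: A_def q_number_def base_powr_def)
  qed
  have B: "B = (1 - v) / (1 - q)"
    using ne[OF \<open>b > 0\<close>] pow[of b] pow[of "b * J"]
    by (simp add: B_def v_def q_number_def base_powr_def power_mult)
  have "(\<Sum>i=0..n. of_nat (n choose i) * q_number q L 1 (real a) ^ (n - i) *
            q_number q L 1 (real b) ^ i *
            q_number q L a (real M + real b * x) ^ (n - i) *
            ((q ^ b) ^ ((n - i + 1) * J) * q_number q L b (real J) ^ i)) =
        (\<Sum>i\<le>n. v * (of_nat (n choose i) * B ^ i * (v * A) ^ (n - i)))"
    unfolding atMost_atLeast0
  proof (rule sum.cong [OF refl])
    fix i
    \<comment> \<open>Of the exponent n - i + 1, the part n - i attaches one \<open>v\<close> to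
      each \<open>A\<close>. The remaining 1 is the outer factor that later turns s into s +
      1.\<close>
    have "(q ^ b) ^ ((n - i + 1) * J) = v * v ^ (n - i)"
      by (metis v_def power_mult mult.commute power_Suc Suc_eq_plus1)
    then show "of_nat (n choose i) * q_number q L 1 (real a) ^ (n - i) *
            q_number q L 1 (real b) ^ i *
            q_number q L a (real M + real b * x) ^ (n - i) *
            ((q ^ b) ^ ((n - i + 1) * J) * q_number q L b (real J) ^ i) =
          v * (of_nat (n choose i) * B ^ i * (v * A) ^ (n - i))"
      unfolding A_def B_def by (simp only: power_mult_distrib mult_ac)
  qed
  also have "\<dots> = v * (B + v * A) ^ n"
    by (simp only: binomial_ring sum_distrib_left)
  also have "B + v * A = (Y * (u * v) + 1) / (1 - q)"
    unfolding A B add_divide_distrib[symmetric] times_divide_eq_right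
    by (simp add: algebra_simps)
  also have "v * \<dots> ^ n = v * (\<Sum>s\<le>n. of_nat (n choose s) * (Y * (u * v)) ^ s) / (1 - q) ^ n"
    by (simp only: binomial_ring power_divide power_one mult_1_right times_divide_eq_right)
  also have "\<dots> = (\<Sum>s\<le>n. of_nat (n choose s) * Y ^ s / (1 - q) ^ n * u ^ s * v ^ (s + 1))"
    unfolding sum_distrib_left sum_divide_distrib
    by (intro sum.cong refl) (simp add: power_mult_distrib)
  finally show ?thesis
    unfolding u_def v_def Y_def .
qed

section \<open>Closed form of one side and its symmetry\<close>

text \<open>The right-hand side is invariant under exchanging \<open>a\<close> and \<open>b\<close>.
  Only \<open>a\<close> has to be odd here: the finite sum has length \<open>a * N\<close>, which
  must be an odd period.\<close>

lemma q_Euler_power_sum_convolution: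
  assumes "odd N" "\<And>k. chi (int (k + N)) = chi (int k)"
    and q: "norm q < 1" "exp L = q" and "a > 0" "b > 0" "odd a"
  defines "f \<equiv> alternating_series chi"
  shows "q_number q L b 2 ^ r *
       (\<Sum>i=0..n. of_nat (n choose i) *
          q_number q L 1 (real a) ^ (n - i) * q_number q L 1 (real b) ^ i *
          q_Euler_poly r chi q L a (n - i) (real b * x) *
          alt_q_power_sum r chi q L b n i (a * N)) =
     q_number q L a 2 ^ r * q_number q L b 2 ^ r *
       (\<Sum>s\<le>n. of_nat (n choose s) * (- exp (of_real (real a * real b * x) * L)) ^ s / (1 - q) ^ n *
          (f ((q ^ a) ^ (s + 1)) * f ((q ^ b) ^ (s + 1)) * (1 + q ^ (a * b * N * (s + 1)))) ^ r)"
    (is "_ * ?lhs = _ * (\<Sum>s\<le>n. ?C s * _)")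
proof -
  define P where "P = {1..r} \<rightarrow>\<^sub>E (UNIV :: nat set)"
  define J where "J = {1..r} \<rightarrow>\<^sub>E {..<a * N}"
  define W where "W z m = (\<Prod>l=1..r. (- z) ^ m l * chi (int (m l)))" for z and m :: "nat \<Rightarrow> nat"
  \<comment> \<open>\<open>G m\<close> is the left-hand sum with each Euler polynomial replaced by
    the m-th term of its series. Computing the sum of \<open>G\<close> in two ways proves the
    claim.\<close>
  define G where "G m = (\<Sum>i=0..n. of_nat (n choose i) *
          q_number q L 1 (real a) ^ (n - i) * q_number q L 1 (real b) ^ i *
          (q_number q L a 2 ^ r * W (q ^ a) m *
            q_number q L a (real (\<Sum>l=1..r. m l) + real b * x) ^ (n - i)) *
          alt_q_power_sum r chi q L b n i (a * N))" for m
  define T where "T s = (\<Sum>j\<in>J. W ((q ^ b) ^ (s + 1)) j)" for s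
  have "N > 0"
    using \<open>odd N\<close> by (rule odd_pos)
  have small: "norm ((q ^ c) ^ (s + 1)) < 1" if "c > 0" for c s
    using q(1) that by (simp add: norm_power power_less_one_iff flip: power_mult power_Suc)
  have G_lhs: "(G has_sum ?lhs) P"
    unfolding G_def P_def W_def
    by (intro has_sum_sum_left has_sum_cmult_left has_sum_cmult_right
          q_Euler_poly_has_sum[of N chi, OF \<open>N > 0\<close> assms(2) q \<open>a > 0\<close>])
  have G_eq: "G m = q_number q L a 2 ^ r * (\<Sum>s\<le>n. ?C s * T s * W ((q ^ a) ^ (s + 1)) m)" for m
  proof -
    have S: "alt_q_power_sum r chi q L b n i (a * N) =
        (\<Sum>j\<in>J. W 1 j * ((q ^ b) ^ ((n - i + 1) * (\<Sum>l=1..r. j l)) *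
                    q_number q L b (real (\<Sum>l=1..r. j l)) ^ i))" for i
      unfolding alt_q_power_sum_def J_def W_def
      by (simp add: prod.distrib power_sum mult.assoc del: of_nat_sum)
    have "G m = (\<Sum>j\<in>J. q_number q L a 2 ^ r * W (q ^ a) m * W 1 j *
        (\<Sum>i=0..n. of_nat (n choose i) *
          q_number q L 1 (real a) ^ (n - i) * q_number q L 1 (real b) ^ i *
          q_number q L a (real (\<Sum>l=1..r. m l) + real b * x) ^ (n - i) *
          ((q ^ b) ^ ((n - i + 1) * (\<Sum>l=1..r. j l)) * q_number q L b (real (\<Sum>l=1..r. j l)) ^ i)))"
      unfolding G_def S sum_distrib_left
      by (subst sum.swap) (simp only: mult_ac)
    also have "\<dots> = (\<Sum>j\<in>J. \<Sum>s\<le>n. q_number q L a 2 ^ r * ?C s *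
        (W (q ^ a) m * ((q ^ a) ^ (\<Sum>l=1..r. m l)) ^ s) *
        (W 1 j * ((q ^ b) ^ (\<Sum>l=1..r. j l)) ^ (s + 1)))"
      unfolding q_binomial_sum[OF q \<open>a > 0\<close> \<open>b > 0\<close>]
      unfolding sum_distrib_left by (simp only: mult_ac)
    \<comment> \<open>Both bases reach exponent s + 1: for m the weight \<open>q ^ a\<close> meets
      an s-th power, while for j the weight 1 meets an (s + 1)-st power.\<close>
    also have "\<dots> = (\<Sum>j\<in>J. \<Sum>s\<le>n. q_number q L a 2 ^ r * ?C s *
        W ((q ^ a) ^ (s + 1)) m * W ((q ^ b) ^ (s + 1)) j)"
      unfolding W_def prod_power_shift by simp
    also have "\<dots> = q_number q L a 2 ^ r * (\<Sum>s\<le>n. ?C s * T s * W ((q ^ a) ^ (s + 1)) m)"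
      unfolding T_def sum_distrib_left sum_distrib_right
      by (subst sum.swap) (simp only: mult_ac)
    finally show ?thesis .
  qed
  \<comment> \<open>Absolute summability lets the sum over r-tuples factor into r equal
    one-dimensional series.\<close>
  have W_sum: "(W z has_sum f z ^ r) P" if "norm z < 1" for z
  proof -
    note abs = alternating_series_abs_summable[of N chi, OF \<open>N > 0\<close> assms(2) that]
    have "W z summable_on P"
      unfolding W_def P_def
      by (rule abs_summable_summable[OF abs_summable_on_prod_PiE_nat[OF abs]]) simp
    moreover have "infsum (W z) P = f z ^ r"
      unfolding W_def P_def f_def alternating_series_def
      by (subst infsum_prod_PiE_abs[where f = "\<lambda>_ k. (- z) ^ k * chi (int k)"]) (use abs in simp_all)
    ultimately show ?thesis
      by (simp add: has_sum_iff)
  qed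
  have "(G has_sum (q_number q L a 2 ^ r * (\<Sum>s\<le>n. ?C s * T s * f ((q ^ a) ^ (s + 1)) ^ r))) P"
    unfolding G_eq
    by (intro has_sum_cmult_right has_sum_sum_left W_sum small \<open>a > 0\<close>)
  then have lhs: "?lhs = q_number q L a 2 ^ r * (\<Sum>s\<le>n. ?C s * T s * f ((q ^ a) ^ (s + 1)) ^ r)"
    using G_lhs has_sum_unique by blast
  have per: "chi (int (k + a * N)) = chi (int k)" for k
  proof (induction a)
    case (Suc a)
    then show ?case
      using assms(2)[of "k + a * N"] by (simp add: algebra_simps)
  qed simp
  have T: "T s = ((1 + q ^ (a * b * N * (s + 1))) * f ((q ^ b) ^ (s + 1))) ^ r" for s
  proof -
    \<comment> \<open>The same factorization for the finite box, where each factor is a sum over an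
      odd period of \<open>chi\<close>.\<close>
    have "T s = (\<Prod>l=1..r. \<Sum>k<a * N. (- ((q ^ b) ^ (s + 1))) ^ k * chi (int k))"
      unfolding T_def J_def W_def
      by (subst prod_sum_PiE) simp_all
    also have "\<dots> = ((1 + ((q ^ b) ^ (s + 1)) ^ (a * N)) * f ((q ^ b) ^ (s + 1))) ^ r"
      using sum_alternating_eq_series[of "a * N" chi, OF _ per small[OF \<open>b > 0\<close>]] \<open>odd N\<close> \<open>odd a\<close>
      by (simp add: f_def)
    also have "((q ^ b) ^ (s + 1)) ^ (a * N) = q ^ (a * b * N * (s + 1))"
      unfolding power_mult[symmetric] by (simp only: mult_ac)
    finally show ?thesis .
  qed
  show ?thesis
    unfolding lhs T by (simp only: power_mult_distrib mult_ac)
qed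

theorem theorem3:
  fixes d r a b n :: nat and chi :: "int \<Rightarrow> complex" and q L :: complex and x :: real
  assumes "odd d"
    and "dirichlet_character d chi"
    and "dirichlet_conductor d chi = d"
    and "r \<ge> 1"
    and "0 < norm q" and "norm q < 1"
    and "exp L = q"
    and "[a = 1] (mod 2)" and "[b = 1] (mod 2)"
  shows
    "q_number q L b 2 ^ r *
       (\<Sum>i=0..n. of_nat (n choose i) *
          q_number q L 1 (real a) ^ (n - i) * q_number q L 1 (real b) ^ i *
          q_Euler_poly r chi q L a (n - i) (real b * x) *
          alt_q_power_sum r chi q L b n i (a * d)) =
     q_number q L a 2 ^ r *
       (\<Sum>i=0..n. of_nat (n choose i) *
          q_number q L 1 (real b) ^ (n - i) * q_number q L 1 (real a) ^ i *
          q_Euler_poly r chi q L b (n - i) (real a * x) *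
          alt_q_power_sum r chi q L a n i (b * d))"
proof -
  have per: "chi (int (k + d)) = chi (int k)" for k
  proof -
    have "[int (k + d) = int k] (mod int d)"
      by (simp add: cong_def)
    then show ?thesis
      using assms(2) unfolding dirichlet_character_def by blast
  qed
  have "odd a" "odd b"
    using assms(8,9) by (simp_all add: cong_def odd_iff_mod_2_eq_one)
  then have "a > 0" "b > 0"
    by (simp_all add: odd_pos)
  note conv = q_Euler_power_sum_convolution[of d chi, OF \<open>odd d\<close> per assms(6,7)]
  \<comment> \<open>Rewriting each side by the closed form, once with \<open>a\<close> and
    \<open>b\<close> exchanged, leaves expressions that differ only in the order of factors.\<close>
  show ?thesis
    unfolding conv[OF \<open>a > 0\<close> \<open>b > 0\<close> \<open>odd a\<close>] conv[OF \<open>b > 0\<close> \<open>a > 0\<close> \<open>odd b\<close>]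
    by (simp only: mult_ac)
qed

end
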